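(* For every context $\Gamma$ and formula $C$ there exists a finitary term $N_{\Gamma\Rightarrow C}\in\overline{\lambda}^{gfp}_{\Sigma}$ with no free occurrences of fixpoint variables such that $[\![N_{\Gamma\Rightarrow C}]\!]=\mathcal{S}(\Gamma\Rightarrow C)$.
   Context: Formulas are built from atoms by implication $\supset$ (associating to the right); contexts are finite lists of declarations with distinct variables; $|\Gamma|$ is the set of formulas declared in $\Gamma$; $\Gamma\le\Gamma'$ means $\Gamma\subseteq\Gamma'$ and $|\Gamma|=|\Gamma'|$. A sequent $\sigma=(\Gamma\Rightarrow p)$ pairs a context with an atom; $(\Gamma\Rightarrow p)\le(\Gamma'\Rightarrow p')$ means $\Gamma\le\Gamma'$ and $p=p'$. Böhm forests and elimination alternatives are the possibly infinite expressions generated coinductively by $N::=_{co}\lambda x^A.N\mid E_1+\cdots+E_n$, $E::=_{co}x\langle N_1,\dots,N_k\rangle$ ($n,k\ge0$); equality of Böhm forests is coinductive (bisimilarity) with sums of alternatives treated as sets ($+$ associative, commutative, idempotent, empty sum $\mathbb{O}$ neutral). The solution space is defined corecursively by $\mathcal{S}(\Gamma\Rightarrow A\supset B)=\lambda x^A.\mathcal{S}(\Gamma,x:A\Rightarrow B)$ ($x$ fresh) and $\mathcal{S}(\Gamma\Rightarrow p)=\sum_{(y:B_1\supset\cdots\supset B_k\supset p)\in\Gamma}y\langle\mathcal{S}(\Gamma\Rightarrow B_1),\dots,\mathcal{S}(\Gamma\Rightarrow B_k)\rangle$ for $p$ an atom. For $\Gamma\le\Gamma'$, co-contraction $[\Gamma'/\Gamma]$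 on Böhm forests is defined by corecursion: $[\Gamma'/\Gamma](\lambda x^A.N)=\lambda x^A.[\Gamma',x:A/\Gamma,x:A]N$; $[\Gamma'/\Gamma]\sum_iE_i=\sum_i[\Gamma'/\Gamma]E_i$; $[\Gamma'/\Gamma](z\langle N_1,\dots,N_k\rangle)=z\langle[\Gamma'/\Gamma]N_1,\dots\rangle$ if $z$ is not declared in $\Gamma$, and $=\sum_{(w:\Gamma(z))\in\Gamma'}w\langle[\Gamma'/\Gamma]N_1,\dots,[\Gamma'/\Gamma]N_k\rangle$ if $z$ is declared in $\Gamma$ with formula $\Gamma(z)$; for sequents, $[(\Gamma'\Rightarrow p)/(\Gamma\Rightarrow p)]:=[\Gamma'/\Gamma]$. The finitary calculus $\overline{\lambda}^{gfp}_{\Sigma}$ has inductively defined terms $N::=\lambda x^A.N\mid\mathrm{gfp}\,X^{\sigma}.(E_1+\cdots+E_n)\mid X^{\sigma}$ and elimination alternatives $E::=x\langle N_1,\dots,N_k\rangle$, where fixpoint variables $X$ (bound by $\mathrm{gfp}$) are annotated with sequents $\sigma$. An environment $\xi$ assigns Böhm forests to annotated fixpoint variables $X^{\sigma}$, with no $X$ occurring with two different annotations in its domain. The interpretation is: $[\![X^{\sigma'}]\!]_\xi=[\sigma'/\sigma]\,\xi(X^{\sigma})$ if $X^{\sigma}$ is in the domain of $\xi$ and $\sigma\le\sigma'$ (some fixed default value otherwise); $[\![\lambda x^A.N]\!]_\xi=\lambda x^A.[\![N]\!]_\xi$; $[\![x\langle N_1,\dots,N_k\rangle]\!]_\xi=x\langle[\![N_1]\!]_\xi,\dots,[\![N_k]\!]_\xi\rangle$;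 $[\![\mathrm{gfp}\,X^{\sigma}.\sum_iE_i]\!]_\xi$ is the unique Böhm forest $N$ with $N=\sum_i[\![E_i]\!]_{\xi\cup[X^{\sigma}\mapsto N]}$ (the binding of $X^\sigma$ replacing any previous binding of $X$). For a term without free fixpoint variables, $[\![N]\!]$ denotes its interpretation (independent of the environment). *)

theory Defs
  imports Main "HOL-Library.FSet"
begin

text \<open>
  Binding of \<open>\<lambda>\<close>-variables is rendered by de Bruijn indices, in contexts as well as in
  Boehm forests and finitary terms: variables are natural numbers, and beneath a binder the
  bound variable is \<open>0\<close> while every other variable \<open>y\<close> has become \<open>Suc y\<close>. Hence the bound
  variable is always fresh, and \<open>\<alpha>\<close>-equivalent expressions are equal. Fixpoint variables are
  named. The type \<open>'a\<close> is the type of atoms.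
\<close>

section \<open>Formulas, contexts and sequents\<close>

datatype 'a fm =
    is_Atom: Atom (atom: 'a)
  | is_Imp: Imp (ante: "'a fm") (succe: "'a fm")  (infixr \<open>\<supset>\<close> 60)

primrec fm_args :: "'a fm \<Rightarrow> 'a fm list" where
  "fm_args (Atom p) = []"
| "fm_args (A \<supset> B) = A # fm_args B"

primrec fm_target :: "'a fm \<Rightarrow> 'a" where
  "fm_target (Atom p) = p"
| "fm_target (A \<supset> B) = fm_target B"

lemma fm_args_target_iff:
  "fm_args B = Bs \<and> fm_target B = p \<longleftrightarrow> B = foldr (\<supset>) Bs (Atom p)"
  by (induction B arbitrary: Bs; case_tac Bs) auto

typedef 'a ctx = "{\<Gamma> :: (nat \<times> 'a fm) list. distinct (map fst \<Gamma>)}"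
  morphisms decls Ctx
  by (rule exI[of _ "[]"]) simp

definition lookup :: "'a ctx \<Rightarrow> nat \<Rightarrow> 'a fm option" where
  "lookup \<Gamma> = map_of (decls \<Gamma>)"

definition formulas :: "'a ctx \<Rightarrow> 'a fm set" where
  "formulas \<Gamma> = snd ` set (decls \<Gamma>)"

definition ctx_le :: "'a ctx \<Rightarrow> 'a ctx \<Rightarrow> bool" where
  "ctx_le \<Gamma> \<Gamma>' \<longleftrightarrow> set (decls \<Gamma>) \<subseteq> set (decls \<Gamma>') \<and> formulas \<Gamma> = formulas \<Gamma>'"

definition lift_decls :: "(nat \<times> 'a fm) list \<Rightarrow> (nat \<times> 'a fm) list" where
  "lift_decls = map (\<lambda>(y, B). (Suc y, B))"

text \<open>
  \<open>lift_ctx \<Gamma>\<close> is \<open>\<Gamma>\<close> as seen from beneath one more binder; \<open>ext_ctx \<Gamma> A\<close> is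
  \<open>\<Gamma>, x : A\<close> with \<open>x\<close> the variable of that binder.
\<close>

definition lift_ctx :: "'a ctx \<Rightarrow> 'a ctx" where
  "lift_ctx \<Gamma> = Ctx (lift_decls (decls \<Gamma>))"

definition ext_ctx :: "'a ctx \<Rightarrow> 'a fm \<Rightarrow> 'a ctx" where
  "ext_ctx \<Gamma> A = Ctx ((0, A) # lift_decls (decls \<Gamma>))"

lemma distinct_lift_decls: "distinct (map fst (lift_decls D)) = distinct (map fst D)"
  by (auto simp: lift_decls_def distinct_map comp_def case_prod_unfold inj_on_def)

lemma decls_lift_ctx: "decls (lift_ctx \<Gamma>) = lift_decls (decls \<Gamma>)"
  unfolding lift_ctx_def
  by (rule Ctx_inverse) (use decls[of \<Gamma>] in \<open>simp add: distinct_lift_decls\<close>)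

lemma decls_ext_ctx: "decls (ext_ctx \<Gamma> A) = (0, A) # lift_decls (decls \<Gamma>)"
  unfolding ext_ctx_def
  by (rule Ctx_inverse)
    (use decls[of \<Gamma>] distinct_lift_decls[of "decls \<Gamma>"] in \<open>auto simp: lift_decls_def\<close>)

type_synonym 'a sequent = "'a ctx \<times> 'a"

definition seq_le :: "'a sequent \<Rightarrow> 'a sequent \<Rightarrow> bool" where
  "seq_le \<sigma> \<sigma>' \<longleftrightarrow> ctx_le (fst \<sigma>) (fst \<sigma>') \<and> snd \<sigma> = snd \<sigma>'"

definition lift_seq :: "'a sequent \<Rightarrow> 'a sequent" where
  "lift_seq = map_prod lift_ctx id"

section \<open>Boehm forests\<close>

text \<open>
  \<open>App x [N\<^sub>1, \<dots>, N\<^sub>k]\<close> is the elimination alternative \<open>x\<langle>N\<^sub>1, \<dots>, N\<^sub>k\<rangle>\<close>. Since sums are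
  finite sets of alternatives, equality on the codatatype is bisimilarity modulo
  associativity, commutativity and idempotence of \<open>+\<close> and neutrality of the empty sum.
\<close>

datatype 'n alt = App nat "'n list"

codatatype 'a forest =
    is_Lam: Lam (lam_type: "'a fm") (lam_body: "'a forest")
  | is_Alts: Alts (alts: "'a forest alt fset")

definition goal_alts :: "'a ctx \<Rightarrow> 'a \<Rightarrow> 'a fm alt fset" where
  "goal_alts \<Gamma> p = fset_of_list [App y (fm_args B). (y, B) \<leftarrow> decls \<Gamma>, fm_target B = p]"

primcorec sol :: "'a ctx \<Rightarrow> 'a fm \<Rightarrow> 'a forest" where
  "sol \<Gamma> C = (case C of
      A \<supset> B \<Rightarrow> Lam A (sol (ext_ctx \<Gamma> A) B)
    | Atom p \<Rightarrow> Alts (fimage (map_alt (sol \<Gamma>)) (goal_alts \<Gamma> p)))"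

lemma sol_simps:
  "sol \<Gamma> (A \<supset> B) = Lam A (sol (ext_ctx \<Gamma> A) B)"
  "sol \<Gamma> (Atom p) = Alts (fimage (map_alt (sol \<Gamma>)) (goal_alts \<Gamma> p))"
  by (subst sol.code, simp)+

text \<open>
  \<open>cocontr \<Gamma>' \<Gamma>\<close> is co-contraction \<open>[\<Gamma>'/\<Gamma>]\<close>. The head of each alternative is expanded before
  the arguments are processed, and the resulting sums of alternatives are merged.
\<close>

fun expand_head :: "'a ctx \<Rightarrow> 'a ctx \<Rightarrow> 'n alt \<Rightarrow> 'n alt fset" where
  "expand_head \<Gamma>' \<Gamma> (App z Ns) = (case lookup \<Gamma> z of
      None \<Rightarrow> {|App z Ns|}
    | Some A \<Rightarrow> fset_of_list [App w Ns. (w, B) \<leftarrow> decls \<Gamma>', B = A])"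

primcorec cocontr :: "'a ctx \<Rightarrow> 'a ctx \<Rightarrow> 'a forest \<Rightarrow> 'a forest" where
  "cocontr \<Gamma>' \<Gamma> M = (case M of
      Lam A N \<Rightarrow> Lam A (cocontr (ext_ctx \<Gamma>' A) (ext_ctx \<Gamma> A) N)
    | Alts Es \<Rightarrow>
        Alts (fimage (map_alt (cocontr \<Gamma>' \<Gamma>)) (ffUnion (fimage (expand_head \<Gamma>' \<Gamma>) Es))))"

lemma cocontr_simps:
  "cocontr \<Gamma>' \<Gamma> (Lam A N) = Lam A (cocontr (ext_ctx \<Gamma>' A) (ext_ctx \<Gamma> A) N)"
  "cocontr \<Gamma>' \<Gamma> (Alts Es) =
     Alts (fimage (map_alt (cocontr \<Gamma>' \<Gamma>)) (ffUnion (fimage (expand_head \<Gamma>' \<Gamma>) Es)))"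
  by (subst cocontr.code, simp)+

definition seq_cocontr :: "'a sequent \<Rightarrow> 'a sequent \<Rightarrow> 'a forest \<Rightarrow> 'a forest" where
  "seq_cocontr \<sigma>' \<sigma> = cocontr (fst \<sigma>') (fst \<sigma>)"

fun rename_head :: "(nat \<Rightarrow> nat) \<Rightarrow> 'n alt \<Rightarrow> 'n alt" where
  "rename_head f (App z Ns) = App (f z) Ns"

primcorec rename :: "(nat \<Rightarrow> nat) \<Rightarrow> 'a forest \<Rightarrow> 'a forest" where
  "rename f M = (case M of
      Lam A N \<Rightarrow> Lam A (rename (case_nat 0 (Suc \<circ> f)) N)
    | Alts Es \<Rightarrow> Alts (fimage (map_alt (rename f)) (fimage (rename_head f) Es)))"

definition lift_forest :: "'a forest \<Rightarrow> 'a forest" where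
  "lift_forest = rename Suc"

section \<open>Finitary terms and their interpretation\<close>

datatype 'a tm =
    TLam "'a fm" "'a tm"
  | Gfp nat "'a sequent" "'a tm alt list"
  | FVar nat "'a sequent"

text \<open>
  \<open>(X, k, \<sigma>') \<in> fpv N\<close> means that \<open>X\<close> annotated with \<open>\<sigma>'\<close> occurs free in \<open>N\<close> beneath \<open>k\<close>
  \<open>\<lambda>\<close>-binders, so a sequent \<open>\<sigma>\<close> given at the root of \<open>N\<close> has to be lifted \<open>k\<close> times before it
  is compared with \<open>\<sigma>'\<close>. A binder for \<open>X\<close> annotated with \<open>\<sigma>\<close> binds just the occurrences of
  \<open>X\<close> whose annotation \<open>\<sigma>'\<close> satisfies \<open>\<sigma> \<le> \<sigma>'\<close>.
\<close>

primrec fpv :: "'a tm \<Rightarrow> (nat \<times> nat \<times> 'a sequent) set" where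
  "fpv (FVar X \<sigma>) = {(X, 0, \<sigma>)}"
| "fpv (TLam A N) = {(X, Suc k, \<sigma>) | X k \<sigma>. (X, k, \<sigma>) \<in> fpv N}"
| "fpv (Gfp X \<sigma> Es) =
     (\<Union>E \<in> set (map (map_alt fpv) Es). \<Union> (set_alt E))
       - {(X, k, \<sigma>') | k \<sigma>'. seq_le ((lift_seq ^^ k) \<sigma>) \<sigma>'}"

text \<open>
  An environment maps \<open>X\<close> to its annotation and its value. Entering a \<open>\<lambda>\<close>-abstraction
  lifts both, so that the free variables of the environment are not captured. The default value is
  \<^const>\<open>undefined\<close>, one fixed but unspecified forest. The definite description for \<open>Gfp\<close>
  denotes the unique solution: the recursive occurrences of \<open>N\<close> are guarded by \<open>App\<close>.
\<close>

type_synonym 'a env = "nat \<Rightarrow> ('a sequent \<times> 'a forest) option"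

definition lift_env :: "'a env \<Rightarrow> 'a env" where
  "lift_env \<xi> = (\<lambda>X. map_option (map_prod lift_seq lift_forest) (\<xi> X))"

primrec interp :: "'a tm \<Rightarrow> 'a env \<Rightarrow> 'a forest" where
  "interp (FVar X \<sigma>') \<xi> = (case \<xi> X of
      Some (\<sigma>, N) \<Rightarrow> if seq_le \<sigma> \<sigma>' then seq_cocontr \<sigma>' \<sigma> N else undefined
    | None \<Rightarrow> undefined)"
| "interp (TLam A N) \<xi> = Lam A (interp N (lift_env \<xi>))"
| "interp (Gfp X \<sigma> Es) \<xi> =
     (THE N. N = Alts (fset_of_list (map (map_alt (\<lambda>M. interp M (\<xi>(X \<mapsto> (\<sigma>, N))))) Es)))"

end

theory Submission
  imports Defs
begin

text \<open>
  Build the term by searching for proofs: at a sequent with atomic goal, reuse a fixpoint variable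
  already bound for a sequent below it, and otherwise bind a new one and expand all alternatives.
  This stops by the subformula property, and it denotes the solution space because co-contraction
  maps solution spaces to solution spaces. The delicate point is that the equation of a
  fixpoint has exactly one solution in every environment, since values of free fixpoint variables
  are arbitrary forests. Renaming and co-contraction are both actions of a monoid of substitutions
  on heads, so the interpretation of a term is a forest with finitely many variables in its holes,
  each with a pending substitution. Such guarded equations are solved by corecursion, and
  uniqueness is a bisimulation.
\<close>

section \<open>Head substitution\<close>

text \<open>
  A head substitution sends a head variable, found beneath binders of the listed types
  (outermost first), to a set of head variables.
\<close>

type_synonym 'a hsubst = "'a fm list \<Rightarrow> nat \<Rightarrow> nat fset"

definition hpush :: "'a fm \<Rightarrow> 'a hsubst \<Rightarrow> 'a hsubst" where
  "hpush A h = (\<lambda>As. h (A # As))"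

text \<open>Kleisli composition for finite sets, taken separately beneath each list of binders;
  \<open>k\<close> acts first.\<close>

definition hcomp :: "'a hsubst \<Rightarrow> 'a hsubst \<Rightarrow> 'a hsubst" where
  "hcomp h k = (\<lambda>As z. ffUnion (h As |`| k As z))"

definition hid :: "'a hsubst" where
  "hid = (\<lambda>As z. {|z|})"

fun expand :: "(nat \<Rightarrow> nat fset) \<Rightarrow> 'n alt \<Rightarrow> 'n alt fset" where
  "expand k (App z Ns) = (\<lambda>w. App w Ns) |`| k z"

definition expands :: "(nat \<Rightarrow> nat fset) \<Rightarrow> 'n alt fset \<Rightarrow> 'n alt fset" where
  "expands k Es = ffUnion (expand k |`| Es)"

primcorec act :: "'a hsubst \<Rightarrow> 'a forest \<Rightarrow> 'a forest" where
  "act h M = (case M of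
      Lam A N \<Rightarrow> Lam A (act (hpush A h) N)
    | Alts Es \<Rightarrow> Alts (map_alt (act h) |`| expands (h []) Es))"

lemma act_simps [simp]:
  "act h (Lam A N) = Lam A (act (hpush A h) N)"
  "act h (Alts Es) = Alts (map_alt (act h) |`| expands (h []) Es)"
  by (subst act.code, simp)+

section \<open>Laws of head substitutions and their action on forests\<close>

lemma mem_ffUnion_image: "x |\<in>| ffUnion (f |`| S) \<longleftrightarrow> (\<exists>y. y |\<in>| S \<and> x |\<in>| f y)"
  by (auto simp: ffUnion.rep_eq)

lemma mem_expands:
  "E |\<in>| expands k Es \<longleftrightarrow> (\<exists>z w Ns. App z Ns |\<in>| Es \<and> w |\<in>| k z \<and> E = App w Ns)"
proof
  assume "E |\<in>| expands k Es"
  then obtain F where F: "F |\<in>| Es" "E |\<in>| expand k F"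
    by (auto simp: expands_def mem_ffUnion_image)
  then show "\<exists>z w Ns. App z Ns |\<in>| Es \<and> w |\<in>| k z \<and> E = App w Ns"
    by (cases F) auto
next
  assume "\<exists>z w Ns. App z Ns |\<in>| Es \<and> w |\<in>| k z \<and> E = App w Ns"
  then show "E |\<in>| expands k Es"
    by (force simp: expands_def mem_ffUnion_image)
qed

text \<open>Only heads are replaced, so expansion is natural in the arguments.\<close>

lemma expands_map: "expands k (map_alt f |`| Es) = map_alt f |`| expands k Es"
proof (rule fset_eqI)
  fix E
  show "E |\<in>| expands k (map_alt f |`| Es) \<longleftrightarrow> E |\<in>| map_alt f |`| expands k Es"
  proof
    assume "E |\<in>| expands k (map_alt f |`| Es)"
    then obtain z w Ns F where "F |\<in>| Es" "App z Ns = map_alt f F" "w |\<in>| k z" "E = App w Ns"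
      by (auto simp: mem_expands)
    then show "E |\<in>| map_alt f |`| expands k Es"
      by (cases F) (force simp: mem_expands)
  next
    assume "E |\<in>| map_alt f |`| expands k Es"
    then show "E |\<in>| expands k (map_alt f |`| Es)"
      by (force simp: mem_expands)
  qed
qed

lemma expands_hcomp: "expands (h As) (expands (k As) Es) = expands (hcomp h k As) Es"
  by (rule fset_eqI) (simp add: mem_expands hcomp_def mem_ffUnion_image, blast)

lemma expands_hid [simp]: "expands (hid As) Es = Es"
proof (rule fset_eqI)
  show "E |\<in>| expands (hid As) Es \<longleftrightarrow> E |\<in>| Es" for E
    by (cases E) (auto simp: mem_expands hid_def)
qed

lemma hpush_hcomp [simp]: "hpush A (hcomp h k) = hcomp (hpush A h) (hpush A k)"
  by (simp add: hpush_def hcomp_def)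

lemma hpush_hid [simp]: "hpush A hid = hid"
  by (simp add: hpush_def hid_def)

lemma hcomp_hid [simp]: "hcomp h hid = h"
  by (simp add: hcomp_def hid_def fun_eq_iff)

lemma hcomp_assoc: "hcomp (hcomp h k) l = hcomp h (hcomp k l)"
  by (intro ext fset_eqI) (auto simp: hcomp_def mem_ffUnion_image)

text \<open>Both sums are images of the same finite set, so each alternative is paired with itself.
  This settles the sum case of the bisimulations below.\<close>

lemma rel_fset_map_altI:
  assumes "\<And>x. R (f x) (g x)"
  shows "rel_fset (rel_alt R) (map_alt f |`| Es) (map_alt g |`| Es)"
  unfolding fset.rel_map alt.rel_map
  by (rule fset.rel_refl, rule alt.rel_refl) (rule assms)

lemma act_act: "act h (act k M) = act (hcomp h k) M"
proof (coinduction arbitrary: h k M)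
  case Eq_forest
  show ?case
  proof (cases M)
    case (Alts Es)
    then show ?thesis
      by (auto simp: expands_map expands_hcomp fset.map_comp alt.map_comp comp_def
          intro!: rel_fset_map_altI)
  qed auto
qed

lemma act_hid [simp]: "act hid M = M"
proof (coinduction arbitrary: M)
  case Eq_forest
  show ?case
  proof (cases M)
    case (Alts Es)
    \<comment> \<open>Writing the right-hand side as an image under \<open>id\<close> turns both
      sides into images of \<open>Es\<close>.\<close>
    have "rel_fset (rel_alt (\<lambda>x y. \<exists>M. x = act hid M \<and> y = M))
        (map_alt (act hid) |`| Es) (map_alt id |`| Es)"
      by (rule rel_fset_map_altI) auto
    with Alts show ?thesis
      by (simp add: alt.map_id0 fset.map_id)
  qed auto
qed

section \<open>Renaming and co-contraction as head substitutions\<close>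

fun ren_subst :: "(nat \<Rightarrow> nat) \<Rightarrow> 'a hsubst" where
  "ren_subst f [] z = {|f z|}"
| "ren_subst f (A # As) z = ren_subst (case_nat 0 (Suc \<circ> f)) As z"

text \<open>Both contexts are extended at each binder crossed, which is why head substitutions are
  indexed by the types of the binders.\<close>

fun coc_subst :: "'a ctx \<Rightarrow> 'a ctx \<Rightarrow> 'a hsubst" where
  "coc_subst \<Gamma>' \<Gamma> [] z = (case lookup \<Gamma> z of
      None \<Rightarrow> {|z|}
    | Some A \<Rightarrow> fset_of_list [w. (w, B) \<leftarrow> decls \<Gamma>', B = A])"
| "coc_subst \<Gamma>' \<Gamma> (A # As) z = coc_subst (ext_ctx \<Gamma>' A) (ext_ctx \<Gamma> A) As z"

lemma hpush_ren_subst [simp]: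
  "hpush A (ren_subst f) = ren_subst (case_nat 0 (Suc \<circ> f))"
  by (simp add: hpush_def fun_eq_iff)

lemma hpush_coc_subst [simp]:
  "hpush A (coc_subst \<Gamma>' \<Gamma>) = coc_subst (ext_ctx \<Gamma>' A) (ext_ctx \<Gamma> A)"
  by (simp add: hpush_def fun_eq_iff)

lemma rename_eq_act: "rename f (M :: 'a forest) = act (ren_subst f) M"
proof (coinduction arbitrary: f M)
  case Eq_forest
  show ?case
  proof (cases M)
    case (Lam A N)
    then show ?thesis by auto
  next
    case (Alts Es)
    have "expand ((ren_subst f :: 'a hsubst) []) E = {|rename_head f E|}" for E :: "'a forest alt"
      by (cases E) simp
    then have "expands ((ren_subst f :: 'a hsubst) []) Es = rename_head f |`| Es"
      by (intro fset_eqI) (auto simp: expands_def mem_ffUnion_image)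
    then have ren: "rename f (Alts Es) = Alts (map_alt (rename f) |`| expands ((ren_subst f :: 'a hsubst) []) Es)"
      by (subst rename.code) (simp only: forest.case)
    show ?thesis
      unfolding Alts ren act_simps by (auto intro!: rel_fset_map_altI)
  qed
qed

lemma cocontr_eq_act: "cocontr \<Gamma>' \<Gamma> M = act (coc_subst \<Gamma>' \<Gamma>) M"
proof (coinduction arbitrary: \<Gamma>' \<Gamma> M)
  case Eq_forest
  show ?case
  proof (cases M)
    case (Lam A N)
    then show ?thesis by auto
  next
    case (Alts Es)
    have "expand_head \<Gamma>' \<Gamma> E = expand (coc_subst \<Gamma>' \<Gamma> []) E" for E :: "'a forest alt"
    proof (cases E)
      case (App z Ns)
      show ?thesis
        unfolding App
        by (intro fset_eqI)
          (auto simp: fset_of_list.rep_eq fset_of_list_elem split: option.splits)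
    qed
    then have "ffUnion (expand_head \<Gamma>' \<Gamma> |`| Es) = expands (coc_subst \<Gamma>' \<Gamma> []) Es"
      unfolding expands_def by presburger
    with Alts show ?thesis
      by (auto intro!: rel_fset_map_altI)
  qed
qed

section \<open>Forests with holes\<close>

text \<open>Atoms are a dead parameter, so that \<open>map_hforest\<close> acts on the labels of the
  holes alone.\<close>

codatatype (dead 'a, 'h) hforest =
    HLam "'a fm" "('a, 'h) hforest"
  | HAlts "('a, 'h) hforest alt fset"
  | Hole 'h

primcorec plug :: "('h \<Rightarrow> 'a forest) \<Rightarrow> ('a, 'h) hforest \<Rightarrow> 'a forest" where
  "plug v g = (case g of
      HLam A g' \<Rightarrow> Lam A (plug v g')
    | HAlts Es \<Rightarrow> Alts (map_alt (plug v) |`| Es)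
    | Hole x \<Rightarrow> v x)"

lemma plug_simps [simp]:
  "plug v (HLam A g) = Lam A (plug v g)"
  "plug v (HAlts Es) = Alts (map_alt (plug v) |`| Es)"
  "plug v (Hole x) = v x"
  by (subst plug.code, simp)+

lemma plug_map: "plug v (map_hforest f g) = plug (v \<circ> f) g"
proof (coinduction arbitrary: g rule: forest.coinduct_strong)
  case Eq_forest
  show ?case
  proof (cases g)
    case (HAlts Es)
    then show ?thesis
      by (auto simp: fset.map_comp alt.map_comp comp_def intro!: rel_fset_map_altI)
  qed (auto intro!: fset.rel_refl alt.rel_refl)
qed

text \<open>A forest read as one without holes; it represents the default value of a variable that
  has no matching binding.\<close>

primcorec embed :: "'a forest \<Rightarrow> ('a, 'h) hforest" where
  "embed M = (case M of
      Lam A N \<Rightarrow> HLam A (embed N)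
    | Alts Es \<Rightarrow> HAlts (map_alt embed |`| Es))"

lemma embed_simps [simp]:
  "embed (Lam A N) = HLam A (embed N)"
  "embed (Alts Es) = HAlts (map_alt embed |`| Es)"
  by (subst embed.code, simp)+

lemma plug_embed [simp]: "plug v (embed M) = M"
proof (coinduction arbitrary: M)
  case Eq_forest
  show ?case
  proof (cases M)
    case (Alts Es)
    have "rel_fset (rel_alt (\<lambda>x y. \<exists>M. x = plug v (embed M) \<and> y = M))
        (map_alt (plug v \<circ> embed) |`| Es) (map_alt id |`| Es)"
      by (rule rel_fset_map_altI) auto
    with Alts show ?thesis
      by (simp add: fset.map_comp alt.map_comp alt.map_id0 fset.map_id comp_def)
  qed auto
qed

section \<open>Solutions of guarded equations\<close>

definition holes :: "(nat \<Rightarrow> 'a forest) \<Rightarrow> nat \<times> 'a hsubst \<Rightarrow> 'a forest" where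
  "holes v = (\<lambda>(X, h). act h (v X))"

lemma holes_simp [simp]: "holes v (X, h) = act h (v X)"
  by (simp add: holes_def)

text \<open>
  \<open>solve X Es h g\<close> is \<open>g\<close> acted upon by \<open>h\<close>, with \<open>X\<close> replaced by the solution of
  \<open>X = HAlts Es\<close>. Each hole for \<open>X\<close> uncovers a constructor when unfolded once.
\<close>

primcorec solve ::
  "nat \<Rightarrow> ('a, nat \<times> 'a hsubst) hforest alt fset \<Rightarrow> 'a hsubst \<Rightarrow>
    ('a, nat \<times> 'a hsubst) hforest \<Rightarrow> ('a, nat \<times> 'a hsubst) hforest" where
  "solve X Es h g = (case g of
      HLam A g' \<Rightarrow> HLam A (solve X Es (hpush A h) g')
    | HAlts Fs \<Rightarrow> HAlts (map_alt (solve X Es h) |`| expands (h []) Fs)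
    | Hole x \<Rightarrow> (if fst x = X
        then HAlts (map_alt (solve X Es (hcomp h (snd x))) |`| expands (hcomp h (snd x) []) Es)
        else Hole (fst x, hcomp h (snd x))))"

lemma solve_simps [simp]:
  "solve X Es h (HLam A g) = HLam A (solve X Es (hpush A h) g)"
  "solve X Es h (HAlts Fs) = HAlts (map_alt (solve X Es h) |`| expands (h []) Fs)"
  "solve X Es h (Hole (Y, k)) =
    (if Y = X then solve X Es (hcomp h k) (HAlts Es) else Hole (Y, hcomp h k))"
  by (subst solve.code, simp)+

text \<open>\<open>solve\<close> accumulates substitutions on its way down, so one applied
  afterwards can be composed with them. At a hole for \<open>X\<close> the unfolded sum is again of
  this form, up to associativity of \<open>hcomp\<close>.\<close>

lemma act_plug_solve:
  "act k (plug (holes v) (solve X Es h g)) = plug (holes v) (solve X Es (hcomp k h) g)"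
proof (coinduction arbitrary: k h g rule: forest.coinduct_strong)
  case Eq_forest
  have alts: "rel_fset (rel_alt (\<lambda>x y. (\<exists>k h g.
          x = act k (plug (holes v) (solve X Es h g)) \<and>
          y = plug (holes v) (solve X Es (hcomp k h) g)) \<or> x = y))
        (alts (act k (plug (holes v) (solve X Es h (HAlts Fs)))))
        (alts (plug (holes v) (solve X Es (hcomp k h) (HAlts Fs))))" for k h Fs
    by (auto simp: expands_map expands_hcomp fset.map_comp alt.map_comp comp_def
        intro!: rel_fset_map_altI)
  show ?case
  proof (cases g)
    case (HLam A g')
    then show ?thesis by auto
  next
    case (HAlts Fs)
    then show ?thesis using alts[of k h Fs] by simp
  next
    case (Hole x)
    obtain Y l where x: "x = (Y, l)" by fastforce
    show ?thesis
    proof (cases "Y = X")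
      case True
      with Hole x show ?thesis
        using alts[of k "hcomp h l" Es] by (simp add: hcomp_assoc)
    next
      case False
      with Hole x show ?thesis
        by (auto simp: act_act hcomp_assoc intro!: fset.rel_refl alt.rel_refl)
    qed
  qed
qed

text \<open>At \<open>h = hid\<close> and \<open>g = HAlts Es\<close> this is the fixpoint equation
  for \<open>N\<close>. The bisimulation needs the general form because binders change
  \<open>h\<close> and arguments change \<open>g\<close>.\<close>

lemma plug_solve:
  assumes N: "N = plug (holes v) (solve X Es hid (HAlts Es))"
  shows "plug (holes v) (solve X Es h g) = act h (plug (holes (v(X := N))) g)"
proof (coinduction arbitrary: h g rule: forest.coinduct_strong)
  case Eq_forest
  show ?case
  proof (cases g)
    case (HLam A g')
    then show ?thesis by auto
  next
    case (HAlts Fs)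
    then show ?thesis
      by (auto simp: expands_map fset.map_comp alt.map_comp comp_def intro!: rel_fset_map_altI)
  next
    case (Hole x)
    obtain Y k where x: "x = (Y, k)" by fastforce
    have "plug (holes v) (solve X Es h g) = act h (plug (holes (v(X := N))) g)"
    proof (cases "Y = X")
      case True
      have "act (hcomp h k) N = plug (holes v) (solve X Es (hcomp h k) (HAlts Es))"
        unfolding N by (simp only: act_plug_solve hcomp_hid)
      with True Hole x show ?thesis
        by (simp add: act_act del: solve_simps(2) plug_simps(2))
    next
      case False
      with Hole x show ?thesis by (simp add: act_act)
    qed
    then show ?thesis
      by (auto intro!: fset.rel_refl alt.rel_refl)
  qed
qed

text \<open>Guardedness is the reason: the bisimulation relates any \<open>g\<close> under any
  \<open>h\<close>, and at a hole for \<open>X\<close> one unfolding of both equations exposes the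
  sum \<open>Es\<close>, whose arguments are related again.\<close>

lemma plug_fixpoint_unique:
  assumes N: "N = plug (holes (v(X := N))) (HAlts Es)"
    and M: "M = plug (holes (v(X := M))) (HAlts Es)"
  shows "N = M"
proof -
  have "act h (plug (holes (v(X := N))) g) = act h (plug (holes (v(X := M))) g)" for h g
  proof (coinduction arbitrary: h g rule: forest.coinduct_strong)
    case Eq_forest
    let ?R = "\<lambda>x y. (\<exists>h g. x = act h (plug (holes (v(X := N))) g) \<and>
        y = act h (plug (holes (v(X := M))) g)) \<or> x = y"
    have alts: "rel_fset (rel_alt ?R)
        (alts (act h (plug (holes (v(X := N))) (HAlts Fs))))
        (alts (act h (plug (holes (v(X := M))) (HAlts Fs))))" for h Fs
      by (auto simp: expands_map fset.map_comp alt.map_comp comp_def intro!: rel_fset_map_altI)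
    show ?case
    proof (cases g)
      case (HLam A g')
      then show ?thesis by auto
    next
      case (HAlts Fs)
      then show ?thesis using alts[of h Fs] by simp
    next
      case (Hole x)
      obtain Y k where x: "x = (Y, k)" by fastforce
      show ?thesis
      proof (cases "Y = X")
        case True
        have N': "act l N = act l (plug (holes (v(X := N))) (HAlts Es))"
          and M': "act l M = act l (plug (holes (v(X := M))) (HAlts Es))" for l
          by (simp_all only: N[symmetric] M[symmetric])
        have "is_Alts (act l N)" "is_Alts (act l M)" for l
          by (subst N', simp) (subst M', simp)
        then obtain Fs Gs where
          "act (hcomp h k) N = Alts Fs" "act (hcomp h k) M = Alts Gs"
          unfolding is_Alts_def by blast
        moreover have "rel_fset (rel_alt ?R)
            (alts (act (hcomp h k) N)) (alts (act (hcomp h k) M))"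
          by (subst N', subst M', rule alts)
        ultimately show ?thesis
          using True Hole x by (simp add: act_act)
      next
        case False
        with Hole x show ?thesis
          by (auto intro!: fset.rel_refl alt.rel_refl)
      qed
    qed
  qed
  from this[of hid "HAlts Es"] show ?thesis
    by (simp only: act_hid N[symmetric] M[symmetric])
qed

section \<open>Fixpoints in the interpretation\<close>

text \<open>Annotations are kept apart from values because the shape of an interpretation depends on
  the annotations alone.\<close>

definition env_of :: "(nat \<Rightarrow> 'a sequent option) \<Rightarrow> (nat \<Rightarrow> 'a forest) \<Rightarrow> 'a env" where
  "env_of \<alpha> v = (\<lambda>X. map_option (\<lambda>\<sigma>. (\<sigma>, v X)) (\<alpha> X))"

lemma env_of_upd: "(env_of \<alpha> v)(X \<mapsto> (\<sigma>, N)) = env_of (\<alpha>(X \<mapsto> \<sigma>)) (v(X := N))"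
  by (auto simp: env_of_def)

lemma lift_env_of: "lift_env (env_of \<alpha> v) = env_of (map_option lift_seq \<circ> \<alpha>) (lift_forest \<circ> v)"
  by (auto simp: env_of_def lift_env_def option.map_comp fun_eq_iff intro!: option.map_cong)

lemma env_eq_env_of: "\<exists>\<alpha> v. \<xi> = env_of \<alpha> v"
  by (rule exI[of _ "\<lambda>X. map_option fst (\<xi> X)"], rule exI[of _ "\<lambda>X. snd (the (\<xi> X))"])
    (auto simp: env_of_def fun_eq_iff option.map_comp map_option_case split: option.splits)

lemma alts_eq_plug:
  assumes "\<And>E M v. E \<in> set Es \<Longrightarrow> M \<in> set_alt E \<Longrightarrow> f v M = plug (holes v) (G M)"
  shows "Alts (fset_of_list (map (map_alt (f v)) Es))
    = plug (holes v) (HAlts (fset_of_list (map (map_alt G) Es)))"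
proof -
  have *: "map (map_alt (f v)) Es = map (map_alt (plug (holes v)) \<circ> map_alt G) Es"
    by (auto simp: alt.map_comp assms intro!: alt.map_cong)
  show ?thesis
    unfolding * by (simp add: fset.map_comp)
qed

text \<open>One \<open>g\<close> serves all values \<open>v\<close>: the annotations decide which
  co-contractions are pending and which occurrences take the default value.\<close>

lemma interp_eq_plug:
  "\<exists>g. \<forall>v. interp M (env_of \<alpha> v) = plug (holes v) g"
proof (induction M arbitrary: \<alpha>)
  case (TLam A M)
  obtain g where g: "\<And>v. interp M (env_of (map_option lift_seq \<circ> \<alpha>) v) = plug (holes v) g"
    using TLam by blast
  \<comment> \<open>Lifting the environment renames every value; this is absorbed into the pending
    substitutions.\<close>
  have "holes (lift_forest \<circ> v) = holes v \<circ> apsnd (\<lambda>h. hcomp h (ren_subst Suc))"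
    for v :: "nat \<Rightarrow> 'a forest"
    by (auto simp: fun_eq_iff lift_forest_def rename_eq_act act_act)
  then show ?case
    by (intro exI[of _ "HLam A (map_hforest (apsnd (\<lambda>h. hcomp h (ren_subst Suc))) g)"])
      (simp add: lift_env_of g plug_map)
next
  case (Gfp X \<sigma> Es)
  define G where
    "G M = (SOME g. \<forall>v. interp M (env_of (\<alpha>(X \<mapsto> \<sigma>)) v) = plug (holes v) g)" for M
  have G: "interp M (env_of (\<alpha>(X \<mapsto> \<sigma>)) v) = plug (holes v) (G M)"
    if "E \<in> set Es" "M \<in> set_alt E" for E M v
    using someI_ex[OF Gfp[OF that]] unfolding G_def by blast
  define Fs where "Fs = fset_of_list (map (map_alt G) Es)"
  have body: "Alts (fset_of_list (map (map_alt (\<lambda>M. interp M ((env_of \<alpha> v)(X \<mapsto> (\<sigma>, N))))) Es))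
      = plug (holes (v(X := N))) (HAlts Fs)" for v N
    unfolding env_of_upd Fs_def
    by (rule alts_eq_plug[where f = "\<lambda>v M. interp M (env_of (\<alpha>(X \<mapsto> \<sigma>)) v)"]) (rule G)
  \<comment> \<open>The definite description is meaningful: \<open>solve\<close> provides a solution
    and guardedness makes it the only one.\<close>
  have "interp (Gfp X \<sigma> Es) (env_of \<alpha> v) = plug (holes v) (solve X Fs hid (HAlts Fs))" for v
    unfolding interp.simps body
  proof (rule the_equality)
    show sol: "plug (holes v) (solve X Fs hid (HAlts Fs)) =
        plug (holes (v(X := plug (holes v) (solve X Fs hid (HAlts Fs))))) (HAlts Fs)"
      using plug_solve[OF refl, of v X Fs hid "HAlts Fs"] by (simp only: act_hid)
    show "N = plug (holes v) (solve X Fs hid (HAlts Fs))"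
      if "N = plug (holes (v(X := N))) (HAlts Fs)" for N
      using that sol by (rule plug_fixpoint_unique)
  qed
  then show ?case by blast
next
  case (FVar X \<sigma>')
  show ?case
  proof (cases "\<exists>\<sigma>. \<alpha> X = Some \<sigma> \<and> seq_le \<sigma> \<sigma>'")
    case True
    then obtain \<sigma> where "\<alpha> X = Some \<sigma>" "seq_le \<sigma> \<sigma>'" by blast
    then show ?thesis
      by (intro exI[of _ "Hole (X, coc_subst (fst \<sigma>') (fst \<sigma>))"])
        (simp add: env_of_def seq_cocontr_def cocontr_eq_act)
  next
    case False
    then show ?thesis
      by (intro exI[of _ "embed undefined"]) (auto simp: env_of_def split: option.splits)
  qed
qed

text \<open>Uniqueness holds in every environment, so exhibiting one solution computes the
  fixpoint.\<close>

lemma interp_Gfp_eqI: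
  assumes "N = Alts (fset_of_list (map (map_alt (\<lambda>M. interp M (\<xi>(X \<mapsto> (\<sigma>, N))))) Es))"
  shows "interp (Gfp X \<sigma> Es) \<xi> = N"
proof -
  obtain \<alpha> v where \<xi>: "\<xi> = env_of \<alpha> v" using env_eq_env_of by blast
  have "\<forall>M. \<exists>g. \<forall>v. interp M (env_of (\<alpha>(X \<mapsto> \<sigma>)) v) = plug (holes v) g"
    using interp_eq_plug by blast
  then obtain G where G: "\<And>M v. interp M (env_of (\<alpha>(X \<mapsto> \<sigma>)) v) = plug (holes v) (G M)"
    by (auto dest!: choice)
  have body: "Alts (fset_of_list (map (map_alt (\<lambda>M. interp M (\<xi>(X \<mapsto> (\<sigma>, N))))) Es))
      = plug (holes (v(X := N))) (HAlts (fset_of_list (map (map_alt G) Es)))" for N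
    unfolding \<xi> env_of_upd
    by (rule alts_eq_plug[where f = "\<lambda>v M. interp M (env_of (\<alpha>(X \<mapsto> \<sigma>)) v)"]) (rule G)
  show ?thesis
    unfolding interp.simps body
    using assms unfolding body
    by (rule the_equality) (rule plug_fixpoint_unique, assumption, rule assms[unfolded body])
qed

section \<open>Co-contraction of solution spaces\<close>

lemma mem_goal_alts:
  "E |\<in>| goal_alts \<Gamma> p \<longleftrightarrow>
    (\<exists>y B. (y, B) \<in> set (decls \<Gamma>) \<and> fm_target B = p \<and> E = App y (fm_args B))"
  by (force simp: goal_alts_def fset_of_list_elem)

primrec exts :: "'a ctx \<Rightarrow> 'a fm list \<Rightarrow> 'a ctx" where
  "exts \<Gamma> [] = \<Gamma>"
| "exts \<Gamma> (A # As) = exts (ext_ctx \<Gamma> A) As"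

text \<open>Corresponding heads have the same formula, hence the same arguments to solve, and the
  hypothesis persists beneath a binder by prefixing its type to \<open>As\<close>. Co-contraction
  and lifting are both instances.\<close>

lemma act_sol:
  assumes "\<And>As. {(w, B). \<exists>z. (z, B) \<in> set (decls (exts \<Gamma> As)) \<and> w |\<in>| h As z}
    = set (decls (exts \<Gamma>' As))"
  shows "act h (sol \<Gamma> C) = sol \<Gamma>' C"
  using assms
proof (coinduction arbitrary: h \<Gamma> \<Gamma>' C)
  case Eq_forest
  note compat = Eq_forest[rule_format]
  show ?case
  proof (cases C)
    case (Imp A B)
    have "{(w, B). \<exists>z. (z, B) \<in> set (decls (exts (ext_ctx \<Gamma> A) As)) \<and> w |\<in>| hpush A h As z}
      = set (decls (exts (ext_ctx \<Gamma>' A) As))" for As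
      using compat[of "A # As"] by (simp add: hpush_def)
    with Imp show ?thesis
      by (fastforce simp: sol_simps)
  next
    case (Atom p)
    have "expands (h []) (goal_alts \<Gamma> p) = goal_alts \<Gamma>' p"
      using compat[of "[]"]
      by (intro fset_eqI) (auto simp: mem_expands mem_goal_alts set_eq_iff; blast)
    with Atom Eq_forest show ?thesis
      by (auto simp: sol_simps expands_map fset.map_comp alt.map_comp comp_def
          intro!: rel_fset_map_altI)
  qed
qed

lemma lookup_eq_Some: "lookup \<Gamma> z = Some A \<longleftrightarrow> (z, A) \<in> set (decls \<Gamma>)"
  using decls[of \<Gamma>] by (auto simp: lookup_def)

lemma formulas_ext_ctx: "formulas (ext_ctx \<Gamma> A) = insert A (formulas \<Gamma>)"
  by (force simp: formulas_def decls_ext_ctx lift_decls_def)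

lemma formulas_lift_ctx [simp]: "formulas (lift_ctx \<Gamma>) = formulas \<Gamma>"
  by (force simp: formulas_def decls_lift_ctx lift_decls_def)

lemma ctx_le_ext_ctx: "ctx_le \<Gamma> \<Gamma>' \<Longrightarrow> ctx_le (ext_ctx \<Gamma> A) (ext_ctx \<Gamma>' A)"
  by (auto simp: ctx_le_def formulas_ext_ctx) (auto simp: decls_ext_ctx lift_decls_def)

lemma cocontr_sol:
  assumes "ctx_le \<Gamma> \<Gamma>'"
  shows "cocontr \<Gamma>' \<Gamma> (sol \<Gamma> C) = sol \<Gamma>' C"
  unfolding cocontr_eq_act
proof (rule act_sol)
  show "{(w, B). \<exists>z. (z, B) \<in> set (decls (exts \<Gamma> As)) \<and> w |\<in>| coc_subst \<Gamma>' \<Gamma> As z}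
    = set (decls (exts \<Gamma>' As))" for As
    using assms
  proof (induction As arbitrary: \<Gamma> \<Gamma>')
    case Nil
    \<comment> \<open>Equality of the formula sets gives every declaration of
      \<open>\<Gamma>'\<close> a partner in \<open>\<Gamma>\<close>.\<close>
    have "\<exists>z. (z, B) \<in> set (decls \<Gamma>)" if "(w, B) \<in> set (decls \<Gamma>')" for w B
    proof -
      have "B \<in> formulas \<Gamma>" using that Nil by (force simp: ctx_le_def formulas_def)
      then show ?thesis by (auto simp: formulas_def)
    qed
    moreover have "w |\<in>| coc_subst \<Gamma>' \<Gamma> [] z \<longleftrightarrow> (w, B) \<in> set (decls \<Gamma>')"
      if "(z, B) \<in> set (decls \<Gamma>)" for w z B
      using that by (auto simp flip: lookup_eq_Some simp: fset_of_list_elem)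
    ultimately show ?case by fastforce
  next
    case (Cons A As)
    then show ?case by (simp add: ctx_le_ext_ctx)
  qed
qed

lemma lift_forest_sol: "lift_forest (sol \<Gamma> C) = sol (lift_ctx \<Gamma>) C"
  unfolding lift_forest_def rename_eq_act
proof (rule act_sol)
  show "{(w, B). \<exists>z. (z, B) \<in> set (decls (exts \<Gamma> As)) \<and> w |\<in>| ren_subst Suc As z}
    = set (decls (exts (lift_ctx \<Gamma>) As))" for As
  proof -
    \<comment> \<open>Generalised from \<open>Suc\<close> because a binder turns \<open>f\<close>
      into \<open>case_nat 0 (Suc \<circ> f)\<close>.\<close>
    have "{(w, B). \<exists>z. (z, B) \<in> set (decls (exts \<Gamma> As)) \<and> w |\<in>| ren_subst f As z}
      = set (decls (exts \<Gamma>' As))"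
      if "set (decls \<Gamma>') = map_prod f id ` set (decls \<Gamma>)" for f \<Gamma>'
      using that
    proof (induction As arbitrary: f \<Gamma> \<Gamma>')
      case Nil
      then show ?case by force
    next
      case (Cons A As)
      show ?case
        unfolding exts.simps ren_subst.simps
        by (rule Cons.IH)
          (simp add: Cons.prems decls_ext_ctx lift_decls_def image_image case_prod_unfold)
    qed
    then show ?thesis
      by (simp add: decls_lift_ctx lift_decls_def map_prod_def id_def)
  qed
qed

section \<open>The finitary term\<close>

primrec subfms :: "'a fm \<Rightarrow> 'a fm set" where
  "subfms (Atom p) = {Atom p}"
| "subfms (A \<supset> B) = insert (A \<supset> B) (subfms A \<union> subfms B)"

definition fm_closed :: "'a fm set \<Rightarrow> bool" where
  "fm_closed U \<longleftrightarrow> (\<forall>A B. A \<supset> B \<in> U \<longrightarrow> A \<in> U \<and> B \<in> U)"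

lemma finite_subfms: "finite (subfms C)"
  by (induction C) auto

lemma self_in_subfms: "C \<in> subfms C"
  by (cases C) auto

lemma subfms_mono: "B \<in> subfms C \<Longrightarrow> subfms B \<subseteq> subfms C"
  by (induction C) auto

lemma fm_closed_subfms: "fm_closed (subfms C)"
  unfolding fm_closed_def
proof (intro allI impI)
  fix A B
  assume "A \<supset> B \<in> subfms C"
  from subfms_mono[OF this] show "A \<in> subfms C \<and> B \<in> subfms C"
    using self_in_subfms[of A] self_in_subfms[of B] by auto
qed

lemma fm_args_closed: "fm_closed U \<Longrightarrow> C \<in> U \<Longrightarrow> set (fm_args C) \<subseteq> U"
proof (induction C)
  case (Imp A B)
  then have "A \<in> U" "B \<in> U"
    unfolding fm_closed_def by blast+
  with Imp show ?case by simp
qed simp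

definition sol_env :: "(nat \<Rightarrow> 'a sequent option) \<Rightarrow> 'a env \<Rightarrow> bool" where
  "sol_env \<Xi> \<xi> \<longleftrightarrow> (\<forall>X \<Gamma> p. \<Xi> X = Some (\<Gamma>, p) \<longrightarrow> \<xi> X = Some ((\<Gamma>, p), sol \<Gamma> (Atom p)))"

text \<open>The occurrences captured by the binders recorded in \<open>\<Xi>\<close>, with
  \<open>k\<close> counting abstractions as in \<open>fpv\<close>.\<close>

definition bound_fpv :: "(nat \<Rightarrow> 'a sequent option) \<Rightarrow> (nat \<times> nat \<times> 'a sequent) set" where
  "bound_fpv \<Xi> = {(X, k, \<sigma>') | X k \<sigma> \<sigma>'. \<Xi> X = Some \<sigma> \<and> seq_le ((lift_seq ^^ k) \<sigma>) \<sigma>'}"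

text \<open>Dropping the names of declared variables makes this invariant under lifting and confines
  it to a finite set once the formulas are confined.\<close>

definition seen :: "(nat \<Rightarrow> 'a sequent option) \<Rightarrow> ('a fm set \<times> 'a) set" where
  "seen \<Xi> = map_prod formulas id ` ran \<Xi>"

lemma sol_env_lift:
  "sol_env \<Xi> \<xi> \<Longrightarrow> sol_env (map_option lift_seq \<circ> \<Xi>) (lift_env \<xi>)"
  by (auto simp: sol_env_def lift_env_def lift_seq_def lift_forest_sol)

lemma ran_lift: "ran (map_option lift_seq \<circ> \<Xi>) = lift_seq ` ran \<Xi>"
  unfolding comp_def by (rule ran_map_option)

lemma seen_lift: "seen (map_option lift_seq \<circ> \<Xi>) = seen \<Xi>"
  unfolding seen_def ran_lift
  by (simp add: image_image lift_seq_def map_prod_def case_prod_unfold)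

lemma bound_fpv_lift:
  assumes "(X, k, \<sigma>) \<in> bound_fpv (map_option lift_seq \<circ> \<Xi>)"
  shows "(X, Suc k, \<sigma>) \<in> bound_fpv \<Xi>"
  using assms by (auto simp: bound_fpv_def funpow_Suc_right simp del: funpow.simps(2))

text \<open>
  A fixpoint variable is used as soon as it has been bound with the same formulas in the context
  and the same atom. Each further nested fixpoint thus enlarges \<^const>\<open>seen\<close>, which consists of
  pairs over the finite set of subformulas.
\<close>

lemma finitary_term_exists:
  assumes U: "finite U" "fm_closed U"
    and "formulas \<Gamma> \<subseteq> U" "C \<in> U" "finite (dom \<Xi>)"
    and "\<And>\<Delta> p. (\<Delta>, p) \<in> ran \<Xi> \<Longrightarrow> set (decls \<Delta>) \<subseteq> set (decls \<Gamma>)"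
    and "n = card ((Pow U \<times> fm_target ` U) - seen \<Xi>)"
  shows "\<exists>N. fpv N \<subseteq> bound_fpv \<Xi> \<and> (\<forall>\<xi>. sol_env \<Xi> \<xi> \<longrightarrow> interp N \<xi> = sol \<Gamma> C)"
  using assms(3-)
proof (induction n arbitrary: \<Gamma> C \<Xi> rule: less_induct)
  case (less n)
  note IH = less.IH
  show ?case
    using less.prems
  \<comment> \<open>An implication leaves the measure \<open>n\<close> unchanged, so the goal
    formula decreases within a fixed \<open>n\<close>.\<close>
  proof (induction C arbitrary: \<Gamma> \<Xi>)
    case (Imp A B)
    note prems = Imp.prems
    let ?\<Xi> = "map_option lift_seq \<circ> \<Xi>"
    have AB: "A \<in> U" "B \<in> U" using prems(2) U(2) unfolding fm_closed_def by blast+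
    have "set (decls \<Delta>) \<subseteq> set (decls (ext_ctx \<Gamma> A))" if \<Delta>: "(\<Delta>, p) \<in> ran ?\<Xi>" for \<Delta> p
    proof -
      obtain \<Delta>' where "\<Delta> = lift_ctx \<Delta>'" "(\<Delta>', p) \<in> ran \<Xi>"
        using \<Delta> unfolding ran_lift by (auto simp: lift_seq_def)
      with prems(4) show ?thesis
        by (fastforce simp: decls_lift_ctx decls_ext_ctx lift_decls_def)
    qed
    moreover have "formulas (ext_ctx \<Gamma> A) \<subseteq> U" using prems(1) AB by (simp add: formulas_ext_ctx)
    moreover have "finite (dom ?\<Xi>)" using prems(3) by (simp add: dom_map_option_comp)
    moreover have "n = card ((Pow U \<times> fm_target ` U) - seen ?\<Xi>)"
      unfolding seen_lift by (rule prems(5))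
    ultimately obtain N where N: "fpv N \<subseteq> bound_fpv ?\<Xi>"
      "\<And>\<xi>. sol_env ?\<Xi> \<xi> \<Longrightarrow> interp N \<xi> = sol (ext_ctx \<Gamma> A) B"
      using Imp.IH(2)[of "ext_ctx \<Gamma> A" ?\<Xi>] AB by blast
    have "fpv (TLam A N) \<subseteq> bound_fpv \<Xi>" using N(1) bound_fpv_lift by fastforce
    moreover have "interp (TLam A N) \<xi> = sol \<Gamma> (A \<supset> B)" if "sol_env \<Xi> \<xi>" for \<xi>
      using N(2) sol_env_lift[OF that] by (simp add: sol_simps)
    ultimately show ?case by blast
  next
    case (Atom p)
    note prems = Atom.prems
    show ?case
    proof (cases "(formulas \<Gamma>, p) \<in> seen \<Xi>")
      case True
      then obtain X \<Delta> where X: "\<Xi> X = Some (\<Delta>, p)" "formulas \<Delta> = formulas \<Gamma>"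
        by (auto simp: seen_def ran_def)
      \<comment> \<open>The recorded contexts are included in \<open>\<Gamma>\<close>, which turns
        equality of formula sets into \<open>ctx_le\<close>.\<close>
      then have le: "ctx_le \<Delta> \<Gamma>" using prems(4) by (auto simp: ctx_le_def ran_def)
      have "fpv (FVar X (\<Gamma>, p)) \<subseteq> bound_fpv \<Xi>"
        using X le by (auto simp: bound_fpv_def seq_le_def intro!: exI[of _ 0])
      moreover have "interp (FVar X (\<Gamma>, p)) \<xi> = sol \<Gamma> (Atom p)" if "sol_env \<Xi> \<xi>" for \<xi>
        using that X le by (auto simp: sol_env_def seq_le_def seq_cocontr_def cocontr_sol)
      ultimately show ?thesis by blast
    next
      case False
      \<comment> \<open>Freshness keeps the earlier bindings in the range, so that
        \<open>seen\<close> grows and the measure drops.\<close>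
      obtain X where X: "X \<notin> dom \<Xi>" using prems(3) ex_new_if_finite infinite_UNIV_nat by blast
      let ?\<Xi> = "\<Xi>(X \<mapsto> (\<Gamma>, p))"
      have ran: "ran ?\<Xi> = insert (\<Gamma>, p) (ran \<Xi>)" using X unfolding domIff by (intro ran_map_upd) blast
      have "(formulas \<Gamma>, p) \<in> (Pow U \<times> fm_target ` U) - seen \<Xi>"
        using False prems(1,2) by force
      moreover have "seen ?\<Xi> = insert (formulas \<Gamma>, p) (seen \<Xi>)"
        by (simp add: seen_def ran)
      ultimately have less: "card ((Pow U \<times> fm_target ` U) - seen ?\<Xi>)
          < n"
        unfolding prems(5) using U(1) by (intro psubset_card_mono) auto
      have fin: "finite (dom ?\<Xi>)" using prems(3) by simp
      have sub: "set (decls \<Delta>) \<subseteq> set (decls \<Gamma>)" if "(\<Delta>, q) \<in> ran ?\<Xi>" for \<Delta> q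
        using that prems(4) unfolding ran by blast
      \<comment> \<open>With a smaller measure any formula of \<open>U\<close> is allowed as goal,
        in particular the arguments of all heads.\<close>
      have "\<exists>N. fpv N \<subseteq> bound_fpv ?\<Xi> \<and> (\<forall>\<xi>. sol_env ?\<Xi> \<xi> \<longrightarrow> interp N \<xi> = sol \<Gamma> D)"
        if "D \<in> U" for D
        using less prems(1) that fin sub refl by (rule IH)
      then obtain F where F: "\<And>D. D \<in> U \<Longrightarrow> fpv (F D) \<subseteq> bound_fpv ?\<Xi>"
        "\<And>D \<xi>. D \<in> U \<Longrightarrow> sol_env ?\<Xi> \<xi> \<Longrightarrow> interp (F D) \<xi> = sol \<Gamma> D"
        by metis
      define gs where "gs = [App y (fm_args B). (y, B) \<leftarrow> decls \<Gamma>, fm_target B = p]"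
      have gs: "M \<in> U" if EM: "E \<in> set gs" "M \<in> set_alt E" for E M
      proof -
        obtain y B where B: "(y, B) \<in> set (decls \<Gamma>)" "M \<in> set (fm_args B)"
          using EM by (auto simp: gs_def)
        then have "B \<in> U" using prems(1) by (force simp: formulas_def)
        then show ?thesis using fm_args_closed[OF U(2)] B by blast
      qed
      let ?N = "Gfp X (\<Gamma>, p) (map (map_alt F) gs)"
      have "fpv ?N \<subseteq> bound_fpv ?\<Xi> - {(X, k, \<sigma>') | k \<sigma>'. seq_le ((lift_seq ^^ k) (\<Gamma>, p)) \<sigma>'}"
        using F(1) gs by (fastforce simp: alt.set_map)
      also have "\<dots> \<subseteq> bound_fpv \<Xi>"
        by (auto simp: bound_fpv_def split: if_splits)
      finally have "fpv ?N \<subseteq> bound_fpv \<Xi>" .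
      moreover have "interp ?N \<xi> = sol \<Gamma> (Atom p)" if "sol_env \<Xi> \<xi>" for \<xi>
      \<comment> \<open>It remains to check that the solution space satisfies the equation when
        \<open>X\<close> is bound to that space itself.\<close>
      proof (rule interp_Gfp_eqI)
        have "sol_env ?\<Xi> (\<xi>(X \<mapsto> ((\<Gamma>, p), sol \<Gamma> (Atom p))))"
          using that by (auto simp: sol_env_def)
        then have "map (map_alt (\<lambda>M. interp M (\<xi>(X \<mapsto> ((\<Gamma>, p), sol \<Gamma> (Atom p)))))) (map (map_alt F) gs)
            = map (map_alt (sol \<Gamma>)) gs"
          using F(2) gs by (auto simp: alt.map_comp intro!: alt.map_cong)
        then show "sol \<Gamma> (Atom p) = Alts (fset_of_list (map (map_alt (\<lambda>M.
            interp M (\<xi>(X \<mapsto> ((\<Gamma>, p), sol \<Gamma> (Atom p)))))) (map (map_alt F) gs)))"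
          by (simp only:) (simp add: Atom sol_simps goal_alts_def gs_def fset_of_list_map)
      qed
      ultimately show ?thesis by blast
    qed
  qed
qed

theorem theorem25:
  fixes \<Gamma> :: "'a ctx" and C :: "'a fm"
  shows "\<exists>N :: 'a tm. fpv N = {} \<and> (\<forall>\<xi>. interp N \<xi> = sol \<Gamma> C)"
proof -
  let ?U = "\<Union> (subfms ` insert C (formulas \<Gamma>))"
  have "finite ?U" by (auto simp: formulas_def finite_subfms)
  moreover have "fm_closed ?U" using fm_closed_subfms unfolding fm_closed_def by blast
  moreover have "formulas \<Gamma> \<subseteq> ?U" "C \<in> ?U" using self_in_subfms by fastforce+
  \<comment> \<open>With no variable recorded, \<open>bound_fpv\<close> is empty and every
    environment satisfies \<open>sol_env\<close>.\<close>
  ultimately obtain N where "fpv N \<subseteq> bound_fpv Map.empty"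
    "\<And>\<xi>. sol_env Map.empty \<xi> \<Longrightarrow> interp N \<xi> = sol \<Gamma> C"
    using finitary_term_exists[of ?U \<Gamma> C Map.empty, OF _ _ _ _ _ _ refl] by auto
  then show ?thesis
    by (auto simp: bound_fpv_def sol_env_def)
qed

end
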